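(* Let $G=(V,E)$ be a finite graph (loops and multiple edges allowed), let $G^{(2)}$ be the graph obtained from $G$ by adding one new vertex on each edge of $G$, and let $V_O$ denote the set of those vertices of $G^{(2)}$ that are original vertices of $G$. Let $\mathcal{D}_{G^{(2)}}$ be the set of matchings of $G^{(2)}$, and for a matching $\mathbf{D}$ let $[\mathbf{D}]$ be the set of vertices covered by $\mathbf{D}$. Then $$\omega_G(1)=\left|\{\mathbf{D}\in\mathcal{D}_{G^{(2)}}\;;\;[\mathbf{D}]\supset V_O\}\right|.$$
   Context: Graphs are finite undirected multigraphs; loops and multiple edges are allowed. The degree of a vertex is the number of edge-ends at it (a loop counts twice). For $s\subset E$, $d_i(s)$ is the degree of vertex $i$ in the spanning subgraph $(V,s)$. In $G^{(2)}$ each edge of $G$ is replaced by a path of two edges through the new vertex (a loop is replaced by two parallel edges joining its vertex to the new vertex). A matching is a set of edges no two of which share a vertex; parallel edges are distinct. The polynomials $f_n(x)$, $n\ge 0$, are defined by $f_0(x)=1$, $f_1(x)=0$, $f_{n+1}(x)=x f_n(x)+f_{n-1}(x)$ for $n\ge1$. Put $\theta_G(\beta,\gamma):=\sum_{s\subset E}\beta^{|s|}\prod_{i\in V}f_{d_i(s)}(\gamma)$ and $$\omega_G(\beta):=\frac{\theta_G(\beta,2\sqrt{-1})}{(1-\beta)^{|E|-|V|}},$$ which is a polynomial in $\mathbb{Z}[\beta]$; $\omega_G(1)$ is the value of this polynomial at $\beta=1$. *)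

theory Defs
  imports Complex_Main "HOL-Library.Multiset" "HOL-Computational_Algebra.Polynomial"
begin

(* Every edge carries the multiset of its two ends: {#u, v#} for an edge joining u and v,
   {#v, v#} for a loop at v. Distinct edges may have the same ends. *)
record ('v, 'e) mgraph =
  verts :: "'v set"
  edges :: "'e set"
  ends :: "'e \<Rightarrow> 'v multiset"

locale finite_mgraph =
  fixes G :: "('v, 'e) mgraph"
  assumes finite_verts: "finite (verts G)"
    and finite_edges: "finite (edges G)"
    and size_ends: "e \<in> edges G \<Longrightarrow> size (ends G e) = 2"
    and ends_subset: "e \<in> edges G \<Longrightarrow> set_mset (ends G e) \<subseteq> verts G"

definition degree_in :: "('v, 'e) mgraph \<Rightarrow> 'e set \<Rightarrow> 'v \<Rightarrow> nat" where
  "degree_in G s i = (\<Sum>e\<in>s. count (ends G e) i)"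

(* The edges of the subdivision are the edge-ends of G: (e, v, k) stands for the k-th end of e
   at v, so a loop e at v gives the two parallel edges (e, v, 0) and (e, v, 1). *)
definition subdivision :: "('v, 'e) mgraph \<Rightarrow> ('v + 'e, 'e \<times> 'v \<times> nat) mgraph" where
  "subdivision G =
     \<lparr> verts = Inl ` verts G \<union> Inr ` edges G,
       edges = {(e, v, k). e \<in> edges G \<and> k < count (ends G e) v},
       ends = (\<lambda>(e, v, k). {#Inl v, Inr e#}) \<rparr>"

definition original_verts :: "('v, 'e) mgraph \<Rightarrow> ('v + 'e) set" where
  "original_verts G = Inl ` verts G"

definition matchings :: "('v, 'e) mgraph \<Rightarrow> 'e set set" where
  "matchings G =
     {D. D \<subseteq> edges G \<and>
         (\<forall>a\<in>D. \<forall>b\<in>D. a \<noteq> b \<longrightarrow> set_mset (ends G a) \<inter> set_mset (ends G b) = {})}"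

definition covered :: "('v, 'e) mgraph \<Rightarrow> 'e set \<Rightarrow> 'v set" where
  "covered G D = (\<Union>e\<in>D. set_mset (ends G e))"

fun f_poly :: "nat \<Rightarrow> complex poly" where
  "f_poly 0 = 1"
| "f_poly (Suc 0) = 0"
| "f_poly (Suc (Suc n)) = [:0, 1:] * f_poly (Suc n) + f_poly n"

definition theta :: "('v, 'e) mgraph \<Rightarrow> complex \<Rightarrow> complex \<Rightarrow> complex" where
  "theta G \<beta> \<gamma> =
     (\<Sum>s\<in>Pow (edges G). \<beta> ^ card s * (\<Prod>i\<in>verts G. poly (f_poly (degree_in G s i)) \<gamma>))"

definition omega_quotient :: "('v, 'e) mgraph \<Rightarrow> complex \<Rightarrow> complex" where
  "omega_quotient G \<beta> =
     theta G \<beta> (2 * \<i>) / (1 - \<beta>) powi (int (card (edges G)) - int (card (verts G)))"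

(* Existence and uniqueness of this polynomial are shown in ex1_omega below. *)
definition omega :: "('v, 'e) mgraph \<Rightarrow> int poly" where
  "omega G =
     (THE p. \<forall>\<beta>. \<beta> \<noteq> 1 \<longrightarrow> poly (map_poly of_int p) \<beta> = omega_quotient G \<beta>)"

lemma finite_edges_subdivision:
  assumes "finite_mgraph G"
  shows "finite (edges (subdivision G))"
proof -
  interpret finite_mgraph G by fact
  have "edges (subdivision G) \<subseteq> edges G \<times> verts G \<times> {..<2}"
  proof
    fix x assume "x \<in> edges (subdivision G)"
    then obtain e v k where x: "x = (e, v, k)" "e \<in> edges G" "k < count (ends G e) v"
      by (auto simp: subdivision_def)
    have "v \<in># ends G e"
      using x(3) by (metis count_greater_zero_iff gr_zeroI not_less_zero)
    then have "v \<in> verts G"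
      using ends_subset x(2) by auto
    moreover have "count (ends G e) v \<le> 2"
      using size_ends[OF x(2)] count_le_size by metis
    ultimately show "x \<in> edges G \<times> verts G \<times> {..<2}"
      using x by auto
  qed
  then show ?thesis
    by (rule finite_subset) (auto simp: finite_verts finite_edges)
qed

lemma finite_mgraph_subdivision:
  assumes "finite_mgraph G"
  shows "finite_mgraph (subdivision G)"
proof -
  interpret finite_mgraph G by fact
  show ?thesis
  proof
    show "finite (verts (subdivision G))"
      by (simp add: subdivision_def finite_verts finite_edges)
    show "finite (edges (subdivision G))"
      using assms by (rule finite_edges_subdivision)
  next
    fix x assume "x \<in> edges (subdivision G)"
    then obtain e v k where x: "x = (e, v, k)" "e \<in> edges G" "k < count (ends G e) v"
      by (auto simp: subdivision_def)
    have "v \<in># ends G e"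
      using x(3) by (metis count_greater_zero_iff gr_zeroI not_less_zero)
    then have "v \<in> verts G"
      using ends_subset x(2) by auto
    then show "set_mset (ends (subdivision G) x) \<subseteq> verts (subdivision G)"
      using x by (auto simp: subdivision_def)
    show "size (ends (subdivision G) x) = 2"
      using x by (simp add: subdivision_def)
  qed
qed

lemma poly_f_poly_2i: "poly (f_poly n) (2 * \<i>) = \<i> ^ n * of_int (1 - int n)"
  by (induction n rule: f_poly.induct) (auto simp: algebra_simps)

lemma sum_degree_in:
  assumes "finite_mgraph G" "s \<subseteq> edges G"
  shows "(\<Sum>i\<in>verts G. degree_in G s i) = 2 * card s"
proof -
  interpret finite_mgraph G by fact
  have "(\<Sum>i\<in>verts G. degree_in G s i) = (\<Sum>e\<in>s. \<Sum>i\<in>verts G. count (ends G e) i)"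
    unfolding degree_in_def by (rule sum.swap)
  also have "\<dots> = (\<Sum>e\<in>s. 2)"
  proof (rule sum.cong[OF refl])
    fix e assume "e \<in> s"
    then have e: "e \<in> edges G" using assms(2) by auto
    have "(\<Sum>i\<in>verts G. count (ends G e) i) = (\<Sum>i\<in>set_mset (ends G e). count (ends G e) i)"
      by (rule sum.mono_neutral_right)
        (use ends_subset[OF e] in \<open>auto simp: finite_verts not_in_iff\<close>)
    then show "(\<Sum>i\<in>verts G. count (ends G e) i) = 2"
      using size_ends[OF e] by (simp add: size_multiset_overloaded_eq)
  qed
  finally show ?thesis by simp
qed

lemma theta_2i:
  assumes "finite_mgraph G"
  shows "theta G \<beta> (2 * \<i>) =
    (\<Sum>s\<in>Pow (edges G). (- \<beta>) ^ card s * of_int (\<Prod>i\<in>verts G. 1 - int (degree_in G s i)))"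
  unfolding theta_def
proof (rule sum.cong[OF refl])
  fix s assume "s \<in> Pow (edges G)"
  then have "s \<subseteq> edges G" by simp
  have "(\<Prod>i\<in>verts G. poly (f_poly (degree_in G s i)) (2 * \<i>)) =
      \<i> ^ (\<Sum>i\<in>verts G. degree_in G s i) * of_int (\<Prod>i\<in>verts G. 1 - int (degree_in G s i))"
    by (simp add: poly_f_poly_2i prod.distrib power_sum)
  also have "\<i> ^ (\<Sum>i\<in>verts G. degree_in G s i) = (- 1) ^ card s"
    by (simp add: sum_degree_in[OF assms \<open>s \<subseteq> edges G\<close>] power_mult)
  finally show "\<beta> ^ card s * (\<Prod>i\<in>verts G. poly (f_poly (degree_in G s i)) (2 * \<i>)) =
      (- \<beta>) ^ card s * of_int (\<Prod>i\<in>verts G. 1 - int (degree_in G s i))"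
    by (simp add: power_minus[of \<beta>])
qed

lemma power_dvd_sum_Pow:
  fixes x :: "'a :: comm_ring_1" and a :: "'v \<Rightarrow> 'a" and c :: "'e \<Rightarrow> 'v \<Rightarrow> 'a"
  assumes "finite W" "finite E"
  shows "(1 + x) ^ (card E - card W) dvd
    (\<Sum>s\<in>Pow E. x ^ card s * (\<Prod>i\<in>W. a i - (\<Sum>e\<in>s. c e i)))"
  using assms
proof (induction W arbitrary: E a rule: finite_induct)
  case empty
  have "(\<Sum>s\<in>Pow E. x ^ card s) = (1 + x) ^ card E"
    using prod_add[OF empty(1), of "\<lambda>_. x" "\<lambda>_. 1"] by (simp add: add.commute)
  then show ?case by simp
next
  case (insert j W)
  let ?P = "\<lambda>a s. \<Prod>i\<in>W. a i - (\<Sum>e\<in>s. c e i)"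
  let ?d = "(1 + x) ^ (card E - card (insert j W))"
  have fin: "finite s" if "s \<in> Pow E" for s
    using that insert.prems finite_subset by auto
  have "(\<Sum>s\<in>Pow E. x ^ card s * (\<Prod>i\<in>insert j W. a i - (\<Sum>e\<in>s. c e i))) =
      (\<Sum>s\<in>Pow E. a j * (x ^ card s * ?P a s)) -
      (\<Sum>s\<in>Pow E. \<Sum>e\<in>s. c e j * (x ^ card s * ?P a s))"
    unfolding sum_subtractf[symmetric]
  proof (rule sum.cong[OF refl])
    fix s
    have "x ^ card s * ((a j - (\<Sum>e\<in>s. c e j)) * ?P a s) =
        a j * (x ^ card s * ?P a s) - (\<Sum>e\<in>s. c e j) * (x ^ card s * ?P a s)"
      by (simp only: left_diff_distrib right_diff_distrib mult_ac)
    then show "x ^ card s * (\<Prod>i\<in>insert j W. a i - (\<Sum>e\<in>s. c e i)) =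
        a j * (x ^ card s * ?P a s) - (\<Sum>e\<in>s. c e j * (x ^ card s * ?P a s))"
      using insert.hyps by (simp only: prod.insert sum_distrib_right not_False_eq_True)
  qed
  also have "(\<Sum>s\<in>Pow E. a j * (x ^ card s * ?P a s)) = a j * (\<Sum>s\<in>Pow E. x ^ card s * ?P a s)"
    by (simp add: sum_distrib_left)
  also have "(\<Sum>s\<in>Pow E. \<Sum>e\<in>s. c e j * (x ^ card s * ?P a s)) =
      (\<Sum>s\<in>Pow E. \<Sum>e\<in>E. if e \<in> s then c e j * (x ^ card s * ?P a s) else 0)"
    by (rule sum.cong[OF refl]) (use insert.prems in \<open>auto simp: sum.If_cases Int_absorb1\<close>)
  also have "\<dots> = (\<Sum>e\<in>E. \<Sum>s\<in>Pow E. if e \<in> s then c e j * (x ^ card s * ?P a s) else 0)"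
    by (rule sum.swap)
  also have "\<dots> = (\<Sum>e\<in>E. c e j * x *
      (\<Sum>t\<in>Pow (E - {e}). x ^ card t * ?P (\<lambda>i. a i - c e i) t))"
  proof (rule sum.cong[OF refl])
    fix e assume e: "e \<in> E"
    have "(\<Sum>s\<in>Pow E. if e \<in> s then c e j * (x ^ card s * ?P a s) else 0) =
        (\<Sum>s\<in>{s \<in> Pow E. e \<in> s}. c e j * (x ^ card s * ?P a s))"
      by (rule sum.inter_filter[symmetric]) (simp add: insert.prems)
    also have "\<dots> = (\<Sum>t\<in>Pow (E - {e}). c e j * x * (x ^ card t * ?P (\<lambda>i. a i - c e i) t))"
    proof (rule sum.reindex_bij_witness[of _ "\<lambda>t. insert e t" "\<lambda>s. s - {e}"])
      fix s assume s: "s \<in> {s \<in> Pow E. e \<in> s}"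
      then have "finite s" using fin by auto
      then have "card s = Suc (card (s - {e}))"
        and "(\<Sum>e\<in>s. c e i) = c e i + (\<Sum>e\<in>s - {e}. c e i)" for i
        using s card.remove[of s e] sum.remove[of s e "\<lambda>e. c e i"] by blast+
      then show "c e j * x * (x ^ card (s - {e}) * ?P (\<lambda>i. a i - c e i) (s - {e})) =
          c e j * (x ^ card s * ?P a s)"
        by (simp only: power_Suc mult_ac diff_diff_eq)
    qed (use e in auto)
    finally show "(\<Sum>s\<in>Pow E. if e \<in> s then c e j * (x ^ card s * ?P a s) else 0) =
        c e j * x * (\<Sum>t\<in>Pow (E - {e}). x ^ card t * ?P (\<lambda>i. a i - c e i) t)"
      by (simp add: sum_distrib_left)
  qed
  finally have eq: "(\<Sum>s\<in>Pow E. x ^ card s * (\<Prod>i\<in>insert j W. a i - (\<Sum>e\<in>s. c e i))) =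
      a j * (\<Sum>s\<in>Pow E. x ^ card s * ?P a s) -
      (\<Sum>e\<in>E. c e j * x * (\<Sum>t\<in>Pow (E - {e}). x ^ card t * ?P (\<lambda>i. a i - c e i) t))" .
  have "?d dvd (1 + x) ^ (card E - card W)"
    by (rule le_imp_power_dvd) (use insert.hyps in auto)
  then have 1: "?d dvd (\<Sum>s\<in>Pow E. x ^ card s * ?P a s)"
    using insert.IH[OF insert.prems] dvd_trans by blast
  have 2: "?d dvd (\<Sum>t\<in>Pow (E - {e}). x ^ card t * ?P (\<lambda>i. a i - c e i) t)" if "e \<in> E" for e
    using insert.IH[of "E - {e}" "\<lambda>i. a i - c e i"] insert.prems insert.hyps that by simp
  show ?case
    unfolding eq by (rule dvd_diff[OF dvd_mult[OF 1] dvd_sum[OF dvd_mult[OF 2]]])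
qed

lemma map_poly_of_int_add:
  "map_poly of_int (p + q) = (map_poly of_int p + map_poly of_int q :: complex poly)"
  by (rule poly_eqI) (simp add: coeff_map_poly)

lemma map_poly_of_int_mult:
  "map_poly of_int (p * q) = (map_poly of_int p * map_poly of_int q :: complex poly)"
  by (rule poly_eqI) (simp add: coeff_map_poly coeff_mult)

lemma map_poly_of_int_sum:
  "map_poly of_int (sum g A) = (\<Sum>a\<in>A. map_poly of_int (g a) :: complex poly)"
  by (induction A rule: infinite_finite_induct) (simp_all add: map_poly_of_int_add)

lemma map_poly_of_int_power:
  "map_poly of_int (p ^ n) = (map_poly of_int p ^ n :: complex poly)"
  by (induction n) (simp_all add: map_poly_of_int_mult)

lemma poly_map_poly_of_int_pCons:
  "poly (map_poly of_int [:a, b:]) z = (of_int a + of_int b * z :: complex)"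
  by (simp add: map_poly_pCons)

lemma ex1_omega:
  assumes "finite_mgraph G"
  shows "\<exists>!p :: int poly.
    \<forall>\<beta>. \<beta> \<noteq> 1 \<longrightarrow> poly (map_poly of_int p) \<beta> = omega_quotient G \<beta>"
proof -
  interpret finite_mgraph G by fact
  let ?ev = "\<lambda>p :: int poly. poly (map_poly of_int p) :: complex \<Rightarrow> complex"
  let ?E = "edges G" and ?V = "verts G"
  define Q :: "int poly" where
    "Q = (\<Sum>s\<in>Pow ?E. [:0, - 1:] ^ card s *
       (\<Prod>i\<in>?V. 1 - (\<Sum>e\<in>s. of_nat (count (ends G e) i))))"
  have Q_coeffs: "Q = (\<Sum>s\<in>Pow ?E. [:0, - 1:] ^ card s *
      of_int (\<Prod>i\<in>?V. 1 - int (degree_in G s i)))"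
    unfolding Q_def degree_in_def by simp
  have ev_of_int: "?ev (of_int k) \<beta> = of_int k" for k \<beta>
    using poly_map_poly_of_int_pCons[of k 0 \<beta>] by (simp add: of_int_poly)
  have ev_x: "?ev [:0, - 1:] \<beta> = - \<beta>" for \<beta>
    using poly_map_poly_of_int_pCons[of 0 "- 1" \<beta>] by simp
  have ev_Q: "?ev Q \<beta> = theta G \<beta> (2 * \<i>)" for \<beta>
    unfolding Q_coeffs theta_2i[OF assms] map_poly_of_int_sum poly_sum
      map_poly_of_int_mult poly_mult map_poly_of_int_power poly_power ev_of_int ev_x ..
  have "1 + [:0, - 1:] = [:1, - 1 :: int:]"
    by (simp add: one_pCons)
  then have "[:1, - 1:] ^ (card ?E - card ?V) dvd Q"
    using power_dvd_sum_Pow[OF finite_verts finite_edges, of "[:0, - 1 :: int:]"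
      "\<lambda>_. 1" "\<lambda>e i. of_nat (count (ends G e) i)"] unfolding Q_def by simp
  then obtain R where R: "Q = [:1, - 1:] ^ (card ?E - card ?V) * R"
    by (elim dvdE)
  define p where "p = [:1, - 1:] ^ (card ?V - card ?E) * R"
  have ev_lin: "?ev [:1, - 1:] \<beta> = 1 - \<beta>" for \<beta>
    using poly_map_poly_of_int_pCons[of 1 "- 1" \<beta>] by simp
  have p: "?ev p \<beta> = omega_quotient G \<beta>" if "\<beta> \<noteq> 1" for \<beta>
  proof -
    have nz: "1 - \<beta> \<noteq> 0" using that by simp
    have th: "theta G \<beta> (2 * \<i>) = (1 - \<beta>) ^ (card ?E - card ?V) * ?ev R \<beta>"
      unfolding ev_Q[symmetric] by (subst R)
        (simp only: map_poly_of_int_mult map_poly_of_int_power poly_mult poly_power ev_lin)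
    have evp: "?ev p \<beta> = (1 - \<beta>) ^ (card ?V - card ?E) * ?ev R \<beta>"
      unfolding p_def
      by (simp only: map_poly_of_int_mult map_poly_of_int_power poly_mult poly_power ev_lin)
    show ?thesis
    proof (cases "card ?V \<le> card ?E")
      case True
      then have e: "int (card ?E) - int (card ?V) = int (card ?E - card ?V)" by simp
      show ?thesis
        unfolding omega_quotient_def th evp e using True nz by (simp del: of_nat_diff)
    next
      case False
      then have e: "int (card ?E) - int (card ?V) = - int (card ?V - card ?E)" by simp
      show ?thesis
        unfolding omega_quotient_def th evp e using False nz
        by (simp add: power_int_minus divide_inverse del: of_nat_diff)
    qed
  qed
  show ?thesis
  proof (rule ex1I[of _ p])
    fix q :: "int poly"
    assume q: "\<forall>\<beta>. \<beta> \<noteq> 1 \<longrightarrow> ?ev q \<beta> = omega_quotient G \<beta>"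
    let ?d = "map_poly of_int q - map_poly of_int p :: complex poly"
    have "- {1} \<subseteq> {\<beta>. poly ?d \<beta> = 0}"
      using p q by auto
    moreover have "infinite (- {1 :: complex})"
      by (simp add: infinite_UNIV_char_0)
    ultimately have "infinite {\<beta>. poly ?d \<beta> = 0}"
      using finite_subset by blast
    then have "map_poly of_int q = (map_poly of_int p :: complex poly)"
      using poly_roots_finite[of ?d] by auto
    then have "coeff (map_poly of_int q :: complex poly) n = coeff (map_poly of_int p) n" for n
      by simp
    then show "q = p"
      by (intro poly_eqI) (simp add: coeff_map_poly)
  qed (use p in blast)
qed

end

theory Submission
  imports Defs
begin

text \<open>
  Write \<open>\<theta>\<close> at \<open>\<gamma> = 2\<i>\<close> as \<open>\<Sum>s. (-\<beta>)^|s| * (\<Prod>i. 1 - d\<^sub>i(s))\<close>, and read \<open>d\<^sub>i(s)\<close> as the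
  number of edge-ends at \<open>i\<close> that belong to an edge of \<open>s\<close>. Multiplying out the product chooses, at
  every vertex, either nothing or one such edge-end with sign \<open>-1\<close>; so it is the sum of \<open>(-1)^|A|\<close>
  over the sets \<open>A\<close> of edge-ends with at most one element at each vertex and all edges in \<open>s\<close>
  (\<open>prod_one_plus_fibre_sums\<close>). After interchanging the sums, the edge sets \<open>s\<close> containing the \<open>m\<close>
  edges of a fixed \<open>A\<close> contribute \<open>(-\<beta>)^m * (1 - \<beta>)^(|E| - m)\<close> (\<open>sum_power_card_between\<close>).
  As \<open>m \<le> |A| \<le> |V|\<close>, the denominator \<open>(1 - \<beta>)^(|E| - |V|)\<close> cancels termwise, which gives
  \<open>\<omega>\<^sub>G(\<beta>) = \<Sum>A. (-1)^|A| * (-\<beta>)^m * (1 - \<beta>)^(|V| - m)\<close> as a polynomial identity (\<open>omega_eq\<close>).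

  At \<open>\<beta> = 1\<close> only the \<open>A\<close> with \<open>m = |V|\<close> survive, each with value \<open>(-1)^|V| * (-1)^|V| = 1\<close>. But the
  edge-ends of \<open>G\<close> are the edges of the subdivision, and \<open>m = |A| = |V|\<close> says that \<open>A\<close>
  has exactly one element at each original vertex and at most one at each new vertex: these \<open>A\<close> are
  the matchings covering all original vertices (\<open>covering_matchings_eq\<close>).
\<close>

section \<open>Two expansions\<close>

lemma inj_on_single_fibre:
  assumes "\<And>h. h \<in> F \<Longrightarrow> p h = j"
  shows "{B. B \<subseteq> F \<and> inj_on p B} = insert {} ((\<lambda>h. {h}) ` F)"
proof
  show "{B. B \<subseteq> F \<and> inj_on p B} \<subseteq> insert {} ((\<lambda>h. {h}) ` F)"
  proof
    fix B assume "B \<in> {B. B \<subseteq> F \<and> inj_on p B}"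
    then have B: "B \<subseteq> F" "inj_on p B" by auto
    show "B \<in> insert {} ((\<lambda>h. {h}) ` F)"
    proof (cases "B = {}")
      case False
      then obtain h where "h \<in> B" by blast
      moreover have "h' = h" if "h' \<in> B" for h'
        using B \<open>h \<in> B\<close> that assms by (metis inj_onD subsetD)
      ultimately have "B = {h}" by blast
      then show ?thesis using B by auto
    qed simp
  qed
qed auto

text \<open>
  Multiplying out the left side picks from every factor either the \<open>1\<close> or one element of the fibre
  over \<open>i\<close>. The set of picked elements determines the picks, and the sets arising in this way are
  those that meet every fibre at most once, that is, those on which \<open>p\<close> is injective.
\<close>

lemma prod_one_plus_fibre_sums:
  fixes y :: "'h \<Rightarrow> 'a :: comm_ring_1"
  assumes "finite V" "finite H" "p ` H \<subseteq> V"
  shows "(\<Prod>i\<in>V. 1 + (\<Sum>h\<in>{h \<in> H. p h = i}. y h)) =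
    (\<Sum>A\<in>{A. A \<subseteq> H \<and> inj_on p A}. \<Prod>h\<in>A. y h)"
  using assms
proof (induction V arbitrary: H rule: finite_induct)
  case empty
  then have "{A. A \<subseteq> H \<and> inj_on p A} = {{}}" by auto
  then show ?case by simp
next
  case (insert j V)
  define F where "F = {h \<in> H. p h = j}"
  let ?T = "\<lambda>H. {A. A \<subseteq> H \<and> inj_on p A}"
  have fin: "finite F" "finite (H - F)"
    using insert.prems by (auto simp: F_def)
  have j: "(\<Sum>B\<in>?T F. prod y B) = 1 + (\<Sum>h\<in>F. y h)"
  proof -
    have "?T F = insert {} ((\<lambda>h. {h}) ` F)"
      by (rule inj_on_single_fibre[of F p j]) (simp add: F_def)
    moreover have "{} \<notin> (\<lambda>h. {h}) ` F" by blast
    ultimately have "(\<Sum>B\<in>?T F. prod y B) = 1 + (\<Sum>B\<in>(\<lambda>h. {h}) ` F. prod y B)"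
      using fin by simp
    also have "(\<Sum>B\<in>(\<lambda>h. {h}) ` F. prod y B) = (\<Sum>h\<in>F. y h)"
      by (subst sum.reindex) (auto simp: inj_on_def)
    finally show ?thesis .
  qed
  have "{h \<in> H - F. p h = i} = {h \<in> H. p h = i}" if "i \<in> V" for i
    using insert.hyps that by (auto simp: F_def)
  then have IH: "(\<Prod>i\<in>V. 1 + (\<Sum>h\<in>{h \<in> H. p h = i}. y h)) = (\<Sum>A\<in>?T (H - F). prod y A)"
    using insert.IH[of "H - F"] insert.prems fin by (force simp: F_def cong: prod.cong)
  have "(\<Prod>i\<in>insert j V. 1 + (\<Sum>h\<in>{h \<in> H. p h = i}. y h)) =
      (\<Sum>B\<in>?T F. prod y B) * (\<Sum>A\<in>?T (H - F). prod y A)"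
    using insert.hyps by (simp add: IH j flip: F_def)
  also have "\<dots> = (\<Sum>(B, A)\<in>?T F \<times> ?T (H - F). prod y B * prod y A)"
    by (simp add: sum_product sum.cartesian_product)
  also have "\<dots> = (\<Sum>A\<in>?T H. prod y A)"
  proof (rule sum.reindex_bij_witness[of _ "\<lambda>A. (A \<inter> F, A - F)" "\<lambda>(B, A). B \<union> A"])
    fix BA assume "BA \<in> ?T F \<times> ?T (H - F)"
    then obtain B A where BA: "BA = (B, A)" "B \<subseteq> F" "inj_on p B" "A \<subseteq> H - F" "inj_on p A"
      by auto
    have "p h \<noteq> p h'" if "h \<in> B" "h' \<in> A" for h h'
    proof -
      have "p h = j" "p h' \<noteq> j" using that BA(2,4) by (auto simp: F_def)
      then show ?thesis by simp
    qed
    then have "inj_on p (B \<union> A)"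
      using BA unfolding inj_on_Un by blast
    then show "(case BA of (B, A) \<Rightarrow> B \<union> A) \<in> ?T H"
      using BA by (auto simp: F_def)
    show "((case BA of (B, A) \<Rightarrow> B \<union> A) \<inter> F, (case BA of (B, A) \<Rightarrow> B \<union> A) - F) = BA"
      using BA by auto
    have "finite B" "finite A" "B \<inter> A = {}"
      using BA fin finite_subset[OF _ fin(1)] finite_subset[OF _ fin(2)] by auto
    then show "prod y (case BA of (B, A) \<Rightarrow> B \<union> A) = (case BA of (B, A) \<Rightarrow> prod y B * prod y A)"
      using BA by (simp add: prod.union_disjoint)
  qed (auto intro: inj_on_subset)
  finally show ?case .
qed

text \<open>A set between \<open>M\<close> and \<open>E\<close> is \<open>M \<union> t\<close> for a unique \<open>t \<subseteq> E - M\<close>: this is the binomial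
  theorem on \<open>E - M\<close>, shifted by \<open>M\<close>.\<close>

lemma sum_power_card_between:
  fixes x :: "'a :: comm_ring_1"
  assumes "finite E" "M \<subseteq> E"
  shows "(\<Sum>s\<in>{s. M \<subseteq> s \<and> s \<subseteq> E}. x ^ card s) = x ^ card M * (1 + x) ^ (card E - card M)"
proof -
  have "(\<Sum>s\<in>{s. M \<subseteq> s \<and> s \<subseteq> E}. x ^ card s) = (\<Sum>t\<in>Pow (E - M). x ^ card M * x ^ card t)"
  proof (rule sum.reindex_bij_witness[of _ "\<lambda>t. M \<union> t" "\<lambda>s. s - M"])
    fix s assume s: "s \<in> {s. M \<subseteq> s \<and> s \<subseteq> E}"
    then have "finite M" "finite s" "card M \<le> card s"
      using assms finite_subset card_mono by blast+
    then show "x ^ card M * x ^ card (s - M) = x ^ card s"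
      using s by (simp add: card_Diff_subset flip: power_add)
  qed (use assms in auto)
  also have "\<dots> = x ^ card M * (\<Sum>t\<in>Pow (E - M). x ^ card t)"
    by (simp add: sum_distrib_left)
  also have "(\<Sum>t\<in>Pow (E - M). x ^ card t) = (1 + x) ^ card (E - M)"
    using prod_add[of "E - M" "\<lambda>_. x" "\<lambda>_. 1"] assms by (simp add: add.commute)
  also have "card (E - M) = card E - card M"
    using assms finite_subset by (blast intro: card_Diff_subset)
  finally show ?thesis .
qed

section \<open>The polynomial as a sum over partial choices of edge-ends\<close>

abbreviation edge_ends :: "('v, 'e) mgraph \<Rightarrow> ('e \<times> 'v \<times> nat) set" where
  "edge_ends G \<equiv> edges (subdivision G)"

text \<open>
  The middle component of an edge-end \<open>(e, v, k)\<close> is its vertex, so injectivity of \<open>fst \<circ> snd\<close>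
  allows at most one edge-end at each vertex. An edge may still be used from both of its ends: then
  \<open>fst ` A\<close> is smaller than \<open>A\<close>.
\<close>

definition partial_choices :: "('v, 'e) mgraph \<Rightarrow> ('e \<times> 'v \<times> nat) set set" where
  "partial_choices G = {A. A \<subseteq> edge_ends G \<and> inj_on (fst \<circ> snd) A}"

lemma finite_partial_choices:
  assumes "finite_mgraph G"
  shows "finite (partial_choices G)"
  using finite_edges_subdivision[OF assms] by (simp add: partial_choices_def)

lemma set_ends_subdivision:
  "set_mset (ends (subdivision G) h) = {Inl ((fst \<circ> snd) h), Inr (fst h)}"
  by (cases h) (simp add: subdivision_def)

lemma edge_ends_at_verts:
  assumes "finite_mgraph G"
  shows "(fst \<circ> snd) ` edge_ends G \<subseteq> verts G"
proof -
  interpret S: finite_mgraph "subdivision G"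
    using assms by (rule finite_mgraph_subdivision)
  have "Inl ((fst \<circ> snd) h) \<in> verts (subdivision G)" if "h \<in> edge_ends G" for h
    using S.ends_subset[OF that] unfolding set_ends_subdivision by simp
  then show ?thesis by (auto simp: subdivision_def)
qed

lemma card_partial_choice:
  assumes "finite_mgraph G" "A \<in> partial_choices G"
  shows "finite A" "fst ` A \<subseteq> edges G" "card (fst ` A) \<le> card A" "card A \<le> card (verts G)"
proof -
  interpret finite_mgraph G by fact
  have A: "A \<subseteq> edge_ends G" "inj_on (fst \<circ> snd) A"
    using assms(2) by (auto simp: partial_choices_def)
  show "finite A"
    using A finite_edges_subdivision[OF assms(1)] finite_subset by blast
  then show "card (fst ` A) \<le> card A"
    by (rule card_image_le)
  show "fst ` A \<subseteq> edges G"
    using A by (auto simp: subdivision_def)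
  have "(fst \<circ> snd) ` A \<subseteq> verts G"
    using edge_ends_at_verts[OF assms(1)] A by blast
  then show "card A \<le> card (verts G)"
    using card_inj_on_le A(2) finite_verts by blast
qed

lemma degree_in_eq_card_edge_ends:
  assumes "finite_mgraph G" "s \<subseteq> edges G"
  shows "degree_in G s i = card {h \<in> {h \<in> edge_ends G. fst h \<in> s}. (fst \<circ> snd) h = i}"
proof -
  interpret finite_mgraph G by fact
  have "{h \<in> {h \<in> edge_ends G. fst h \<in> s}. (fst \<circ> snd) h = i} =
      (\<lambda>(e, k). (e, i, k)) ` (SIGMA e:s. {..<count (ends G e) i})"
    using assms(2) by (force simp: subdivision_def)
  moreover have "inj_on (\<lambda>(e, k). (e, i, k)) X" for X :: "('b \<times> nat) set"
    by (auto simp: inj_on_def)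
  moreover have "finite s"
    using assms(2) finite_edges finite_subset by blast
  ultimately show ?thesis
    by (simp add: degree_in_def card_image card_SigmaI)
qed

lemma prod_one_minus_degree:
  assumes "finite_mgraph G" "s \<subseteq> edges G"
  shows "(\<Prod>i\<in>verts G. 1 - int (degree_in G s i)) =
    (\<Sum>A\<in>{A \<in> partial_choices G. fst ` A \<subseteq> s}. (- 1) ^ card A)"
proof -
  interpret finite_mgraph G by fact
  let ?H = "{h \<in> edge_ends G. fst h \<in> s}"
  have "(\<Prod>i\<in>verts G. 1 - int (degree_in G s i)) =
      (\<Prod>i\<in>verts G. 1 + (\<Sum>h\<in>{h \<in> ?H. (fst \<circ> snd) h = i}. - 1))"
    by (simp add: degree_in_eq_card_edge_ends[OF assms] del: comp_apply)
  also have "\<dots> = (\<Sum>A\<in>{A. A \<subseteq> ?H \<and> inj_on (fst \<circ> snd) A}. \<Prod>h\<in>A. - 1)"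
  proof (rule prod_one_plus_fibre_sums)
    show "(fst \<circ> snd) ` ?H \<subseteq> verts G"
      using edge_ends_at_verts[OF assms(1)] by blast
  qed (use finite_verts finite_edges_subdivision[OF assms(1)] in auto)
  also have "{A. A \<subseteq> ?H \<and> inj_on (fst \<circ> snd) A} = {A \<in> partial_choices G. fst ` A \<subseteq> s}"
    by (auto simp: partial_choices_def)
  finally show ?thesis by simp
qed

text \<open>
  For a fixed choice \<open>A\<close>, the edge sets \<open>s\<close> that admit it are those containing \<open>fst ` A\<close>, so the sum
  over \<open>s\<close> is carried out first.
\<close>

lemma theta_2i_partial_choices:
  assumes "finite_mgraph G"
  shows "theta G \<beta> (2 * \<i>) = (\<Sum>A\<in>partial_choices G.
    (- 1) ^ card A * ((- \<beta>) ^ card (fst ` A) * (1 - \<beta>) ^ (card (edges G) - card (fst ` A))))"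
proof -
  interpret finite_mgraph G by fact
  have "theta G \<beta> (2 * \<i>) = (\<Sum>s\<in>Pow (edges G).
      \<Sum>A\<in>{A \<in> partial_choices G. fst ` A \<subseteq> s}. (- 1) ^ card A * (- \<beta>) ^ card s)"
    unfolding theta_2i[OF assms]
    by (intro sum.cong refl)
      (simp add: prod_one_minus_degree[OF assms] sum_distrib_left mult.commute del: of_int_prod)
  also have "\<dots> = (\<Sum>A\<in>partial_choices G.
      \<Sum>s\<in>{s \<in> Pow (edges G). fst ` A \<subseteq> s}. (- 1) ^ card A * (- \<beta>) ^ card s)"
    by (rule sum.swap_restrict) (use finite_edges finite_partial_choices[OF assms] in auto)
  also have "\<dots> = (\<Sum>A\<in>partial_choices G.
      (- 1) ^ card A * ((- \<beta>) ^ card (fst ` A) * (1 - \<beta>) ^ (card (edges G) - card (fst ` A))))"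
  proof (rule sum.cong[OF refl])
    fix A assume "A \<in> partial_choices G"
    then have "fst ` A \<subseteq> edges G" using card_partial_choice[OF assms] by blast
    moreover have "{s \<in> Pow (edges G). fst ` A \<subseteq> s} = {s. fst ` A \<subseteq> s \<and> s \<subseteq> edges G}" by auto
    ultimately show "(\<Sum>s\<in>{s \<in> Pow (edges G). fst ` A \<subseteq> s}. (- 1) ^ card A * (- \<beta>) ^ card s) =
        (- 1) ^ card A * ((- \<beta>) ^ card (fst ` A) * (1 - \<beta>) ^ (card (edges G) - card (fst ` A)))"
      using sum_power_card_between[of "edges G" "fst ` A" "- \<beta>"] finite_edges
      by (simp add: sum_distrib_left[symmetric])
  qed
  finally show ?thesis .
qed

lemma omega_quotient_partial_choices:
  assumes "finite_mgraph G" "\<beta> \<noteq> 1"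
  shows "omega_quotient G \<beta> = (\<Sum>A\<in>partial_choices G.
    (- 1) ^ card A * ((- \<beta>) ^ card (fst ` A) * (1 - \<beta>) ^ (card (verts G) - card (fst ` A))))"
proof -
  interpret finite_mgraph G by fact
  let ?d = "(1 - \<beta>) powi (int (card (edges G)) - int (card (verts G)))"
  have "(1 - \<beta>) ^ (card (edges G) - card (fst ` A)) / ?d =
      (1 - \<beta>) ^ (card (verts G) - card (fst ` A))"
    if A: "A \<in> partial_choices G" for A
  proof -
    have "card (fst ` A) \<le> card (edges G)"
      using card_mono[OF finite_edges] card_partial_choice(2)[OF assms(1) A] by blast
    moreover have "card (fst ` A) \<le> card (verts G)"
      using card_partial_choice(3,4)[OF assms(1) A] by linarith
    ultimately show ?thesis
      using assms(2) by (simp add: power_int_diff power_diff)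
  qed
  then show ?thesis
    unfolding omega_quotient_def theta_2i_partial_choices[OF assms(1)] sum_divide_distrib
    by (intro sum.cong refl) (metis (no_types, lifting) times_divide_eq_right)
qed

lemma omega_eq:
  assumes "finite_mgraph G"
  shows "omega G = (\<Sum>A\<in>partial_choices G.
    (- 1) ^ card A * ([:0, - 1:] ^ card (fst ` A) * [:1, - 1:] ^ (card (verts G) - card (fst ` A))))"
    (is "_ = ?p")
proof -
  have "poly (map_poly of_int ?p) \<beta> = omega_quotient G \<beta>" if "\<beta> \<noteq> 1" for \<beta>
  proof -
    have "poly (map_poly of_int (- 1)) \<beta> = - 1"
      using poly_map_poly_of_int_pCons[of "- 1" 0 \<beta>] by (simp add: one_pCons)
    moreover have "poly (map_poly of_int [:0, - 1:]) \<beta> = - \<beta>"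
      and "poly (map_poly of_int [:1, - 1:]) \<beta> = 1 - \<beta>"
      using poly_map_poly_of_int_pCons[of 0 "- 1" \<beta>] poly_map_poly_of_int_pCons[of 1 "- 1" \<beta>]
      by simp_all
    ultimately show ?thesis
      by (simp only: omega_quotient_partial_choices[OF assms that] map_poly_of_int_sum poly_sum
          map_poly_of_int_mult poly_mult map_poly_of_int_power poly_power)
  qed
  then show ?thesis
    unfolding omega_def using ex1_omega[OF assms] by (intro the1_equality) blast+
qed

section \<open>The surviving choices are the covering matchings\<close>

lemma matchings_subdivision_iff:
  "D \<in> matchings (subdivision G) \<longleftrightarrow> D \<in> partial_choices G \<and> inj_on fst D"
proof -
  have "set_mset (ends (subdivision G) a) \<inter> set_mset (ends (subdivision G) b) = {} \<longleftrightarrow>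
      (fst \<circ> snd) a \<noteq> (fst \<circ> snd) b \<and> fst a \<noteq> fst b" for a b
    unfolding set_ends_subdivision by auto
  then show ?thesis
    unfolding matchings_def partial_choices_def inj_on_def by blast
qed

lemma covered_subdivision_iff:
  "original_verts G \<subseteq> covered (subdivision G) D \<longleftrightarrow> verts G \<subseteq> (fst \<circ> snd) ` D"
  unfolding original_verts_def covered_def set_ends_subdivision by blast

text \<open>
  In the chain \<open>card (fst ` D) \<le> card D \<le> card (verts G)\<close> the first inequality is an equality iff no
  new vertex is covered twice, and the second iff all original vertices are covered.
\<close>

lemma covering_matchings_eq:
  assumes "finite_mgraph G"
  shows "{D \<in> matchings (subdivision G). covered (subdivision G) D \<supseteq> original_verts G} =
    {D \<in> partial_choices G. card (fst ` D) = card (verts G)}"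
proof -
  interpret finite_mgraph G by fact
  have "inj_on fst D \<and> verts G \<subseteq> (fst \<circ> snd) ` D \<longleftrightarrow> card (fst ` D) = card (verts G)"
    if D: "D \<in> partial_choices G" for D
  proof -
    note le = card_partial_choice[OF assms D]
    have image: "(fst \<circ> snd) ` D \<subseteq> verts G"
      using D edge_ends_at_verts[OF assms] unfolding partial_choices_def by blast
    have "card ((fst \<circ> snd) ` D) = card D"
      using D by (intro card_image) (simp add: partial_choices_def)
    then have "verts G \<subseteq> (fst \<circ> snd) ` D \<longleftrightarrow> card D = card (verts G)"
      using image card_subset_eq[OF finite_verts image] by (metis subset_antisym)
    moreover have "inj_on fst D \<longleftrightarrow> card (fst ` D) = card D"
      using inj_on_iff_eq_card[OF le(1)] .
    ultimately show ?thesis using le(3,4) by linarith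
  qed
  then show ?thesis
    by (auto simp only: matchings_subdivision_iff covered_subdivision_iff)
qed

theorem theorem11:
  fixes G :: "('v, 'e) mgraph"
  assumes "finite_mgraph G"
  shows "poly (omega G) 1 =
    int (card {D \<in> matchings (subdivision G). covered (subdivision G) D \<supseteq> original_verts G})"
proof -
  have "poly (omega G) 1 = (\<Sum>A\<in>partial_choices G.
      (- 1) ^ card A * ((- 1) ^ card (fst ` A) * 0 ^ (card (verts G) - card (fst ` A))))"
    unfolding omega_eq[OF assms] by (simp add: poly_sum)
  also have "\<dots> = (\<Sum>A\<in>partial_choices G. if card (fst ` A) = card (verts G) then 1 else 0)"
  proof (rule sum.cong[OF refl])
    fix A assume "A \<in> partial_choices G"
    then have le: "card (fst ` A) \<le> card A" "card A \<le> card (verts G)"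
      using card_partial_choice[OF assms] by blast+
    show "(- 1) ^ card A * ((- 1) ^ card (fst ` A) * 0 ^ (card (verts G) - card (fst ` A))) =
        (if card (fst ` A) = card (verts G) then 1 else 0 :: int)"
    proof (cases "card (fst ` A) = card (verts G)")
      case True
      then have "card A = card (verts G)" using le by linarith
      then show ?thesis using True by (simp flip: power_add power_mult_distrib)
    next
      case False
      then have "card (verts G) - card (fst ` A) \<noteq> 0" using le by linarith
      then show ?thesis using False by (simp add: power_0_left)
    qed
  qed
  also have "\<dots> = int (card {A \<in> partial_choices G. card (fst ` A) = card (verts G)})"
    using finite_partial_choices[OF assms] by (simp add: sum.If_cases Int_def)
  finally show ?thesis
    unfolding covering_matchings_eq[OF assms] .
qed

end
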